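(* Let $m\ge1$, let $\mathsf{P}(A)\in\mathcal{P}_f(\mathbb{T}^m)$ be the graph of a toral automorphism $A\in\mathrm{GL}(m,\mathbb{Z})$, let $H\subset\mathbb{T}^m$ be a finite subgroup, and let $H'\subset\mathbb{T}^m$ be a finite subgroup containing $H$ which is doubly invariant under $\Pi_{\mathsf{P}(A)}$. If we identify both $\mathbb{T}^m/H$ and $\mathbb{T}^m/H'$ with $\mathbb{T}^m$ (by group isomorphisms), then the correspondence $\mathsf{P}''=\mathsf{P}(A)_{H'}$ is the graph of a toral automorphism $A''\in\mathrm{GL}(m,\mathbb{Z})$ (i.e. $\mathsf{P}''=\mathsf{P}(A'')$), and the correspondence $\mathsf{P}'=\mathsf{P}(A)_H$ has the graph of the automorphism $A''$ as a factor with kernel $(H'/H)\times(H'/H)$.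
   Context: A correspondence of a compact group $G$ is a closed subgroup $\mathsf{P}\subset G\times G$ both of whose coordinate projections onto $G$ are surjective. Its polymorphism is $\Pi_{\mathsf{P}}(x)=\{y:(x,y)\in\mathsf{P}\}$. $\mathcal{P}_f(\mathbb{T}^m)$ denotes the set of correspondences $\mathsf{P}$ of $\mathbb{T}^m=\mathbb{R}^m/\mathbb{Z}^m$ that are finite-to-one, i.e. such that $\{x:(x,0)\in\mathsf{P}\}$ and $\{y:(0,y)\in\mathsf{P}\}$ are finite. For $A\in\mathrm{GL}(m,\mathbb{Z})$, $\mathsf{P}(A)=\{(x,Ax):x\in\mathbb{T}^m\}$. For a correspondence $\mathsf{P}$ of $G$ and a closed normal subgroup $H\subset G$, $\mathsf{P}_H=\mathsf{P}/(H\times H)\subset G/H\times G/H$ is the image of $\mathsf{P}$ under the quotient map. $H$ is doubly invariant under $\Pi_{\mathsf{P}}$ if $\mathsf{P}_H$ is the graph of a continuous automorphism of $G/H$. A correspondence $\mathsf{P}_2$ of $G_2$ is a factor of a correspondence $\mathsf{P}_1$ of $G_1$ if there is a continuous surjective homomorphism $\phi\colon G_1\to G_2$ with $(\phi\times\phi)(\mathsf{P}_1)=\mathsf{P}_2$. Here the factor map is the one induced by the canonical homomorphism $\phi\colon\mathbb{T}^m/H\to\mathbb{T}^m/H'$, and "with kernel $K$" means that $\phi\times\phi\colon\mathbb{T}^m/H\times\mathbb{T}^m/H\to\mathbb{T}^m/H'\times\mathbb{T}^m/H'$ has kernel $K$. For a finite subgroup $F\subset\mathbb{T}^m$ the quotient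 $\mathbb{T}^m/F$ is isomorphic to $\mathbb{T}^m$. *)

theory Defs
  imports "HOL-Analysis.Analysis" "HOL-Algebra.Coset"
begin

text \<open>
  A topological group is a pair of a group \<open>G\<close> and an abstract topology \<open>T\<close> with
  \<open>topspace T = carrier G\<close>.  The definitions below are meant for compact groups and their
  closed normal subgroups.
\<close>

definition quot_topology :: "'a monoid \<Rightarrow> 'a topology \<Rightarrow> 'a set \<Rightarrow> 'a set topology"
  where "quot_topology G T H =
    topology (\<lambda>U. U \<subseteq> carrier (G Mod H) \<and> openin T {x \<in> topspace T. H #>\<^bsub>G\<^esub> x \<in> U})"

lemma openin_quot_topology:
  "openin (quot_topology G T H) U \<longleftrightarrow>
    U \<subseteq> carrier (G Mod H) \<and> openin T {x \<in> topspace T. H #>\<^bsub>G\<^esub> x \<in> U}"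
proof -
  let ?P = "\<lambda>U. U \<subseteq> carrier (G Mod H) \<and> openin T {x \<in> topspace T. H #>\<^bsub>G\<^esub> x \<in> U}"
  have "istopology ?P"
    unfolding istopology_def
  proof (intro conjI allI impI)
    fix S S' assume "?P S" "?P S'"
    moreover have "{x \<in> topspace T. H #>\<^bsub>G\<^esub> x \<in> S \<inter> S'} =
        {x \<in> topspace T. H #>\<^bsub>G\<^esub> x \<in> S} \<inter> {x \<in> topspace T. H #>\<^bsub>G\<^esub> x \<in> S'}"
      by auto
    ultimately show "S \<inter> S' \<subseteq> carrier (G Mod H)"
      and "openin T {x \<in> topspace T. H #>\<^bsub>G\<^esub> x \<in> S \<inter> S'}"
      by auto
  next
    fix K assume "\<forall>S\<in>K. ?P S"
    moreover have "{x \<in> topspace T. H #>\<^bsub>G\<^esub> x \<in> \<Union>K} =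
        (\<Union>S\<in>K. {x \<in> topspace T. H #>\<^bsub>G\<^esub> x \<in> S})"
      by auto
    ultimately show "\<Union>K \<subseteq> carrier (G Mod H)"
      and "openin T {x \<in> topspace T. H #>\<^bsub>G\<^esub> x \<in> \<Union>K}"
      by auto
  qed
  then show ?thesis
    by (simp add: quot_topology_def topology_inverse')
qed

definition correspondence :: "'a monoid \<Rightarrow> 'a topology \<Rightarrow> ('a \<times> 'a) set \<Rightarrow> bool"
  where "correspondence G T P \<longleftrightarrow>
    subgroup P (G \<times>\<times> G) \<and> closedin (prod_topology T T) P \<and>
    fst ` P = carrier G \<and> snd ` P = carrier G"

definition finite_to_one_correspondence :: "'a monoid \<Rightarrow> 'a topology \<Rightarrow> ('a \<times> 'a) set \<Rightarrow> bool"
  where "finite_to_one_correspondence G T P \<longleftrightarrow>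
    correspondence G T P \<and> finite {x. (x, \<one>\<^bsub>G\<^esub>) \<in> P} \<and> finite {y. (\<one>\<^bsub>G\<^esub>, y) \<in> P}"

definition graph_on :: "'a set \<Rightarrow> ('a \<Rightarrow> 'b) \<Rightarrow> ('a \<times> 'b) set"
  where "graph_on S f = {(x, f x) | x. x \<in> S}"

definition quot_correspondence ::
    "'a monoid \<Rightarrow> 'a set \<Rightarrow> ('a \<times> 'a) set \<Rightarrow> ('a set \<times> 'a set) set"
  where "quot_correspondence G H P = (\<lambda>(x, y). (H #>\<^bsub>G\<^esub> x, H #>\<^bsub>G\<^esub> y)) ` P"

definition doubly_invariant ::
    "'a monoid \<Rightarrow> 'a topology \<Rightarrow> ('a \<times> 'a) set \<Rightarrow> 'a set \<Rightarrow> bool"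
  where "doubly_invariant G T P H \<longleftrightarrow>
    H \<lhd> G \<and> closedin T H \<and>
    (\<exists>f \<in> iso (G Mod H) (G Mod H).
      continuous_map (quot_topology G T H) (quot_topology G T H) f \<and>
      quot_correspondence G H P = graph_on (carrier (G Mod H)) f)"

text \<open>
  The kernel \<open>K\<close> in the next definition is that of \<open>\<phi> \<times> \<phi>\<close>, a subgroup of
  \<open>G\<^sub>1 \<times> G\<^sub>1\<close>, and not that of \<open>\<phi>\<close>.
\<close>

definition factor_map_with_kernel ::
    "'a monoid \<Rightarrow> 'a topology \<Rightarrow> ('a \<times> 'a) set \<Rightarrow>
     'b monoid \<Rightarrow> 'b topology \<Rightarrow> ('b \<times> 'b) set \<Rightarrow> ('a \<Rightarrow> 'b) \<Rightarrow> ('a \<times> 'a) set \<Rightarrow> bool"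
  where "factor_map_with_kernel G\<^sub>1 T\<^sub>1 P\<^sub>1 G\<^sub>2 T\<^sub>2 P\<^sub>2 \<phi> K \<longleftrightarrow>
    correspondence G\<^sub>1 T\<^sub>1 P\<^sub>1 \<and> correspondence G\<^sub>2 T\<^sub>2 P\<^sub>2 \<and>
    \<phi> \<in> epi G\<^sub>1 G\<^sub>2 \<and> continuous_map T\<^sub>1 T\<^sub>2 \<phi> \<and>
    map_prod \<phi> \<phi> ` P\<^sub>1 = P\<^sub>2 \<and>
    kernel (G\<^sub>1 \<times>\<times> G\<^sub>1) (G\<^sub>2 \<times>\<times> G\<^sub>2) (map_prod \<phi> \<phi>) = K"

definition topological_iso ::
    "'a monoid \<Rightarrow> 'a topology \<Rightarrow> 'b monoid \<Rightarrow> 'b topology \<Rightarrow> ('a \<Rightarrow> 'b) \<Rightarrow> bool"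
  where "topological_iso G\<^sub>1 T\<^sub>1 G\<^sub>2 T\<^sub>2 \<psi> \<longleftrightarrow> \<psi> \<in> iso G\<^sub>1 G\<^sub>2 \<and> homeomorphic_map T\<^sub>1 T\<^sub>2 \<psi>"

text \<open>
  For \<open>H \<subseteq> H'\<close>, the canonical map \<open>G/H \<rightarrow> G/H'\<close> sends the coset \<open>Hx\<close> to
  \<open>H' \<cdot> Hx = H'x\<close>.
\<close>

definition canonical_map :: "'a monoid \<Rightarrow> 'a set \<Rightarrow> 'a set \<Rightarrow> 'a set"
  where "canonical_map G H' X = H' <#>\<^bsub>G\<^esub> X"

definition vec_group :: "(real^'m) monoid"
  where "vec_group = \<lparr>carrier = UNIV, mult = (+), one = 0\<rparr>"

definition int_lattice :: "(real^'m) set"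
  where "int_lattice = {x. \<forall>i. x $ i \<in> \<int>}"

definition torus :: "(real^'m) set monoid"
  where "torus = vec_group Mod int_lattice"

definition torus_top :: "(real^'m) set topology"
  where "torus_top = quot_topology vec_group euclidean int_lattice"

definition GL_int :: "(int^'m^'m) set"
  where "GL_int = {A. invertible A}"

text \<open>
  \<open>A\<close> acts on the torus by \<open>x + \<int>\<^sup>m \<mapsto> Ax + \<int>\<^sup>m\<close>; for an integer matrix the union
  below is that single coset.
\<close>

definition toral_map :: "int^'m^'m \<Rightarrow> (real^'m) set \<Rightarrow> (real^'m) set"
  where "toral_map A X =
    (\<Union>x\<in>X. int_lattice #>\<^bsub>vec_group\<^esub> (map_matrix real_of_int A *v x))"

definition toral_graph :: "int^'m^'m \<Rightarrow> ((real^'m) set \<times> (real^'m) set) set"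
  where "toral_graph A = graph_on (carrier torus) (toral_map A)"

end

theory Submission
  imports Defs
begin

text \<open>
  Two facts carry the theorem.

  The first is topological algebra and has nothing to do with tori.  For normal subgroups
  \<open>H \<subseteq> H'\<close> of a compact group the cosets satisfy \<open>H'(Hx) = H'x\<close>, so the canonical map
  \<open>G/H \<rightarrow> G/H'\<close> is a continuous epimorphism that takes \<open>P/(H \<times> H)\<close> onto \<open>P/(H' \<times> H')\<close> and
  has kernel \<open>H'/H\<close> (\<open>canonical_map_factor\<close>).  The quotients of \<open>P\<close> are again closed since they
  are compact subsets of Hausdorff groups (\<open>correspondence_image\<close>).  Everything is then carried
  along the identifications of the quotients with the torus (\<open>factor_map_transport\<close>).  These
  identifications also show that the quotients are Hausdorff, because the torus is.

  The second is that every continuous automorphism \<open>f\<close> of the torus is given by a matrix in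
  \<open>GL(m,\<int>)\<close> (\<open>continuous_torus_automorphism_is_toral\<close>).  Double invariance of \<open>H'\<close> makes
  \<open>P/(H' \<times> H')\<close> the graph of a continuous automorphism of the quotient by \<open>H'\<close>, and conjugation
  by \<open>\<psi>'\<close> turns it into such an \<open>f\<close>.  To find the matrix, compose \<open>f\<close> with the projection
  \<open>\<real>\<^sup>m \<rightarrow> T\<^sup>m\<close> and with the coordinate characters \<open>x \<mapsto> exp (2\<pi>i x\<^sub>j)\<close>.  Each component is a
  continuous homomorphism from \<open>\<real>\<^sup>m\<close> to the circle; a continuous logarithm of it exists because
  \<open>\<real>\<^sup>m\<close> is contractible, and the logarithm is linear (\<open>circle_hom_lift\<close>).  So \<open>f\<close> lifts to a
  linear map \<open>L\<close>.  Injectivity of \<open>f\<close> says that \<open>Lx\<close> lies in \<open>\<int>\<^sup>m\<close> exactly if \<open>x\<close> does.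
  Then \<open>L\<close> is injective, as a line on which it vanishes would lie in \<open>\<int>\<^sup>m\<close>; hence it is
  invertible, and both \<open>L\<close> and its inverse map \<open>\<int>\<^sup>m\<close> to itself, so both have integer matrices.
\<close>

section \<open>Correspondences of quotient groups\<close>

lemma topspace_quot_topology:
  assumes "group G" "subgroup H G" "topspace T = carrier G"
  shows "topspace (quot_topology G T H) = carrier (G Mod H)"
proof
  show "topspace (quot_topology G T H) \<subseteq> carrier (G Mod H)"
    unfolding topspace_def openin_quot_topology by blast
  have "{x \<in> topspace T. H #>\<^bsub>G\<^esub> x \<in> carrier (G Mod H)} = topspace T"
    using assms by (auto simp: FactGroup_def RCOSETS_def)
  then have "openin (quot_topology G T H) (carrier (G Mod H))"
    by (simp add: openin_quot_topology)
  then show "carrier (G Mod H) \<subseteq> topspace (quot_topology G T H)"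
    by (rule openin_subset)
qed

lemma quotient_map_coset:
  assumes "group G" "subgroup H G" "topspace T = carrier G"
  shows "quotient_map T (quot_topology G T H) (\<lambda>x. H #>\<^bsub>G\<^esub> x)"
  unfolding quotient_map_def topspace_quot_topology[OF assms]
  using assms(3) by (auto simp: openin_quot_topology FactGroup_def RCOSETS_def)

lemma correspondence_subset:
  assumes "correspondence G T P"
  shows "P \<subseteq> carrier G \<times> carrier G"
proof -
  have "subgroup P (G \<times>\<times> G)"
    using assms by (simp add: correspondence_def)
  then show ?thesis
    by (auto simp: DirProd_def dest!: subgroup.subset)
qed

lemma map_prod_hom_DirProd:
  assumes "\<phi> \<in> hom G\<^sub>1 G\<^sub>2"
  shows "map_prod \<phi> \<phi> \<in> hom (G\<^sub>1 \<times>\<times> G\<^sub>1) (G\<^sub>2 \<times>\<times> G\<^sub>2)"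
  using assms by (auto simp: hom_def DirProd_def)

lemma continuous_map_prod_self:
  assumes "continuous_map T\<^sub>1 T\<^sub>2 \<phi>"
  shows "continuous_map (prod_topology T\<^sub>1 T\<^sub>1) (prod_topology T\<^sub>2 T\<^sub>2) (map_prod \<phi> \<phi>)"
  unfolding map_prod_def by (simp add: continuous_map_prod_top assms)

lemma subgroup_map_prod_image:
  assumes "group G\<^sub>1" "group G\<^sub>2" "\<phi> \<in> hom G\<^sub>1 G\<^sub>2" "subgroup P (G\<^sub>1 \<times>\<times> G\<^sub>1)"
  shows "subgroup (map_prod \<phi> \<phi> ` P) (G\<^sub>2 \<times>\<times> G\<^sub>2)"
proof -
  have "group_hom (G\<^sub>1 \<times>\<times> G\<^sub>1) (G\<^sub>2 \<times>\<times> G\<^sub>2) (map_prod \<phi> \<phi>)"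
    by (intro group_hom.intro group_hom_axioms.intro DirProd_group assms(1,2)
        map_prod_hom_DirProd assms(3))
  then show ?thesis
    using assms(4) by (rule group_hom.subgroup_img_is_subgroup)
qed

lemma map_prod_image_projections:
  assumes "\<phi> ` carrier G\<^sub>1 = carrier G\<^sub>2" "fst ` P = carrier G\<^sub>1" "snd ` P = carrier G\<^sub>1"
  shows "fst ` map_prod \<phi> \<phi> ` P = carrier G\<^sub>2" "snd ` map_prod \<phi> \<phi> ` P = carrier G\<^sub>2"
proof -
  have "fst ` map_prod \<phi> \<phi> ` P = \<phi> ` fst ` P" "snd ` map_prod \<phi> \<phi> ` P = \<phi> ` snd ` P"
    by (simp_all add: image_image)
  then show "fst ` map_prod \<phi> \<phi> ` P = carrier G\<^sub>2" "snd ` map_prod \<phi> \<phi> ` P = carrier G\<^sub>2"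
    by (simp_all add: assms)
qed

text \<open>
  Continuous images of closed sets need not be closed; compactness of the source together with
  the Hausdorff property of the target gives it.
\<close>

lemma correspondence_image:
  assumes "group G\<^sub>1" "group G\<^sub>2" "correspondence G\<^sub>1 T\<^sub>1 P"
    and "compact_space T\<^sub>1" "Hausdorff_space T\<^sub>2"
    and "\<phi> \<in> epi G\<^sub>1 G\<^sub>2" "continuous_map T\<^sub>1 T\<^sub>2 \<phi>"
  shows "correspondence G\<^sub>2 T\<^sub>2 (map_prod \<phi> \<phi> ` P)"
proof -
  have "compactin (prod_topology T\<^sub>1 T\<^sub>1) P"
    using assms by (intro closedin_compact_space)
      (auto simp: correspondence_def compact_space_prod_topology)
  then have "compactin (prod_topology T\<^sub>2 T\<^sub>2) (map_prod \<phi> \<phi> ` P)"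
    using image_compactin continuous_map_prod_self assms(7) by blast
  then have "closedin (prod_topology T\<^sub>2 T\<^sub>2) (map_prod \<phi> \<phi> ` P)"
    using assms(5) by (intro compactin_imp_closedin) (auto simp: Hausdorff_space_prod_topology)
  moreover have "subgroup (map_prod \<phi> \<phi> ` P) (G\<^sub>2 \<times>\<times> G\<^sub>2)"
    using assms by (intro subgroup_map_prod_image[of G\<^sub>1]) (auto simp: correspondence_def epi_def)
  ultimately show ?thesis
    using assms(3,6) map_prod_image_projections[of \<phi> G\<^sub>1 G\<^sub>2 P]
    by (simp add: correspondence_def epi_def)
qed

section \<open>Transport along topological isomorphisms\<close>

lemma topological_iso_inverse:
  assumes "group G\<^sub>1" "topspace T\<^sub>1 = carrier G\<^sub>1" "topological_iso G\<^sub>1 T\<^sub>1 G\<^sub>2 T\<^sub>2 \<psi>"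
  shows "inv_into (carrier G\<^sub>1) \<psi> \<in> iso G\<^sub>2 G\<^sub>1"
    and "continuous_map T\<^sub>2 T\<^sub>1 (inv_into (carrier G\<^sub>1) \<psi>)"
proof -
  show "inv_into (carrier G\<^sub>1) \<psi> \<in> iso G\<^sub>2 G\<^sub>1"
    using assms group.iso_set_sym by (auto simp: topological_iso_def)
  obtain g where g: "homeomorphic_maps T\<^sub>1 T\<^sub>2 \<psi> g"
    using assms(3) by (auto simp: topological_iso_def homeomorphic_map_maps)
  have "inv_into (carrier G\<^sub>1) \<psi> y = g y" if "y \<in> topspace T\<^sub>2" for y
  proof (rule inv_into_f_eq)
    show "inj_on \<psi> (carrier G\<^sub>1)"
      using assms(3) by (auto simp: topological_iso_def iso_def bij_betw_def)
    show "g y \<in> carrier G\<^sub>1" "\<psi> (g y) = y"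
      using g that assms(2) by (auto simp: homeomorphic_maps_def continuous_map_def)
  qed
  then show "continuous_map T\<^sub>2 T\<^sub>1 (inv_into (carrier G\<^sub>1) \<psi>)"
    using g continuous_map_eq[of T\<^sub>2 T\<^sub>1 g] by (simp add: homeomorphic_maps_def)
qed

text \<open>
  Closedness is preserved because the image of \<open>P\<close> is its preimage under the continuous inverse.
\<close>

lemma correspondence_topological_iso:
  assumes "group G\<^sub>1" "group G\<^sub>2" "topspace T\<^sub>1 = carrier G\<^sub>1" "topspace T\<^sub>2 = carrier G\<^sub>2"
    and "topological_iso G\<^sub>1 T\<^sub>1 G\<^sub>2 T\<^sub>2 \<psi>" "correspondence G\<^sub>1 T\<^sub>1 P"
  shows "correspondence G\<^sub>2 T\<^sub>2 (map_prod \<psi> \<psi> ` P)"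
proof -
  define \<theta> where "\<theta> = inv_into (carrier G\<^sub>1) \<psi>"
  have \<psi>: "\<psi> \<in> hom G\<^sub>1 G\<^sub>2" "\<psi> ` carrier G\<^sub>1 = carrier G\<^sub>2" "inj_on \<psi> (carrier G\<^sub>1)"
    using assms(5) by (auto simp: topological_iso_def iso_def bij_betw_def)
  have P: "P \<subseteq> carrier G\<^sub>1 \<times> carrier G\<^sub>1"
    using assms(6) by (rule correspondence_subset)
  have \<theta>: "\<theta> (\<psi> x) = x" if "x \<in> carrier G\<^sub>1" for x
    using \<psi>(3) that by (simp add: \<theta>_def)
  have \<theta>': "\<psi> (\<theta> y) = y" if "y \<in> carrier G\<^sub>2" for y
    using \<psi>(2) that by (simp add: \<theta>_def f_inv_into_f)
  have "map_prod \<psi> \<psi> ` P = {z \<in> topspace (prod_topology T\<^sub>2 T\<^sub>2). map_prod \<theta> \<theta> z \<in> P}"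
  proof (intro equalityI subsetI)
    fix z assume "z \<in> map_prod \<psi> \<psi> ` P"
    then obtain a b where ab: "(a, b) \<in> P" "z = (\<psi> a, \<psi> b)"
      by auto
    moreover have "a \<in> carrier G\<^sub>1" "b \<in> carrier G\<^sub>1"
      using P ab(1) by blast+
    ultimately show "z \<in> {z \<in> topspace (prod_topology T\<^sub>2 T\<^sub>2). map_prod \<theta> \<theta> z \<in> P}"
      by (simp add: \<theta> assms(4) flip: \<psi>(2))
  next
    fix z assume z: "z \<in> {z \<in> topspace (prod_topology T\<^sub>2 T\<^sub>2). map_prod \<theta> \<theta> z \<in> P}"
    then have "map_prod \<psi> \<psi> (map_prod \<theta> \<theta> z) = z"
      by (cases z) (simp add: \<theta>' assms(4))
    then show "z \<in> map_prod \<psi> \<psi> ` P"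
      using z by (metis (no_types, lifting) image_eqI mem_Collect_eq)
  qed
  moreover have "continuous_map (prod_topology T\<^sub>2 T\<^sub>2) (prod_topology T\<^sub>1 T\<^sub>1) (map_prod \<theta> \<theta>)"
    unfolding \<theta>_def by (intro continuous_map_prod_self topological_iso_inverse(2)[OF assms(1,3,5)])
  ultimately have "closedin (prod_topology T\<^sub>2 T\<^sub>2) (map_prod \<psi> \<psi> ` P)"
    using assms(6) closedin_continuous_map_preimage by (metis (no_types) correspondence_def)
  then show ?thesis
    using subgroup_map_prod_image[OF assms(1,2) \<psi>(1)] assms(6)
      map_prod_image_projections[OF \<psi>(2)]
    by (simp add: correspondence_def)
qed

lemma Collect_image:
  assumes "\<And>z. z \<in> S \<Longrightarrow> p (h z) \<longleftrightarrow> q z"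
  shows "{z \<in> h ` S. p z} = h ` {z \<in> S. q z}"
  using assms by blast

text \<open>
  Conjugating \<open>\<phi>\<close> by the isomorphisms moves its kernel by the isomorphism of the source alone:
  \<open>\<psi>'\<close> is injective, so \<open>\<psi>'(\<phi>(x))\<close> is trivial exactly if \<open>\<phi>(x)\<close> is.
\<close>

lemma factor_map_transport:
  assumes "group G\<^sub>1" "group G\<^sub>2" "group G\<^sub>1'" "group G\<^sub>2'"
    and "topspace T\<^sub>1 = carrier G\<^sub>1" "topspace T\<^sub>2 = carrier G\<^sub>2"
    and "topspace T\<^sub>1' = carrier G\<^sub>1'" "topspace T\<^sub>2' = carrier G\<^sub>2'"
    and \<psi>: "topological_iso G\<^sub>1 T\<^sub>1 G\<^sub>1' T\<^sub>1' \<psi>"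
    and \<psi>': "topological_iso G\<^sub>2 T\<^sub>2 G\<^sub>2' T\<^sub>2' \<psi>'"
    and fac: "factor_map_with_kernel G\<^sub>1 T\<^sub>1 P\<^sub>1 G\<^sub>2 T\<^sub>2 P\<^sub>2 \<phi> K"
  shows "factor_map_with_kernel G\<^sub>1' T\<^sub>1' (map_prod \<psi> \<psi> ` P\<^sub>1) G\<^sub>2' T\<^sub>2' (map_prod \<psi>' \<psi>' ` P\<^sub>2)
    (\<psi>' \<circ> \<phi> \<circ> inv_into (carrier G\<^sub>1) \<psi>) (map_prod \<psi> \<psi> ` K)"
proof -
  define \<theta> where "\<theta> = inv_into (carrier G\<^sub>1) \<psi>"
  have i1: "\<psi> \<in> hom G\<^sub>1 G\<^sub>1'" "\<psi> ` carrier G\<^sub>1 = carrier G\<^sub>1'" "inj_on \<psi> (carrier G\<^sub>1)"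
    using \<psi> by (auto simp: topological_iso_def iso_def bij_betw_def)
  have i2: "\<psi>' \<in> hom G\<^sub>2 G\<^sub>2'" "\<psi>' ` carrier G\<^sub>2 = carrier G\<^sub>2'" "inj_on \<psi>' (carrier G\<^sub>2)"
    using \<psi>' by (auto simp: topological_iso_def iso_def bij_betw_def)
  have i3: "\<theta> \<in> hom G\<^sub>1' G\<^sub>1" "\<theta> ` carrier G\<^sub>1' = carrier G\<^sub>1"
    using topological_iso_inverse(1)[OF assms(1,5) \<psi>]
    by (auto simp: \<theta>_def iso_def bij_betw_def)
  have i4: "continuous_map T\<^sub>1' T\<^sub>1 \<theta>"
    unfolding \<theta>_def by (rule topological_iso_inverse(2)[OF assms(1,5) \<psi>])
  have i5: "continuous_map T\<^sub>2 T\<^sub>2' \<psi>'"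
    using \<psi>' by (auto simp: topological_iso_def intro: homeomorphic_imp_continuous_map)
  have \<theta>: "\<theta> (\<psi> x) = x" if "x \<in> carrier G\<^sub>1" for x
    using i1(3) that by (simp add: \<theta>_def)
  have f: "\<phi> \<in> hom G\<^sub>1 G\<^sub>2" "\<phi> ` carrier G\<^sub>1 = carrier G\<^sub>2" "continuous_map T\<^sub>1 T\<^sub>2 \<phi>"
    "map_prod \<phi> \<phi> ` P\<^sub>1 = P\<^sub>2" "kernel (G\<^sub>1 \<times>\<times> G\<^sub>1) (G\<^sub>2 \<times>\<times> G\<^sub>2) (map_prod \<phi> \<phi>) = K"
    "correspondence G\<^sub>1 T\<^sub>1 P\<^sub>1" "correspondence G\<^sub>2 T\<^sub>2 P\<^sub>2"
    using fac by (auto simp: factor_map_with_kernel_def epi_def)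
  have P: "P\<^sub>1 \<subseteq> carrier G\<^sub>1 \<times> carrier G\<^sub>1"
    using f(6) by (rule correspondence_subset)
  have epi: "\<psi>' \<circ> \<phi> \<circ> \<theta> \<in> epi G\<^sub>1' G\<^sub>2'"
  proof -
    have "(\<psi>' \<circ> \<phi> \<circ> \<theta>) ` carrier G\<^sub>1' = carrier G\<^sub>2'"
      by (simp only: image_comp[symmetric] i3(2) f(2) i2(2))
    then show ?thesis
      using hom_compose[OF hom_compose[OF i3(1) f(1)] i2(1)] by (simp add: epi_def o_assoc)
  qed
  have img: "map_prod (\<psi>' \<circ> \<phi> \<circ> \<theta>) (\<psi>' \<circ> \<phi> \<circ> \<theta>) ` map_prod \<psi> \<psi> ` P\<^sub>1 = map_prod \<psi>' \<psi>' ` P\<^sub>2"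
    unfolding f(4)[symmetric] image_image
    by (rule image_cong) (use P \<theta> in auto)
  have one: "\<psi>' y = \<one>\<^bsub>G\<^sub>2'\<^esub> \<longleftrightarrow> y = \<one>\<^bsub>G\<^sub>2\<^esub>" if "y \<in> carrier G\<^sub>2" for y
  proof -
    have "\<psi>' \<one>\<^bsub>G\<^sub>2\<^esub> = \<one>\<^bsub>G\<^sub>2'\<^esub>"
      using i2(1) assms(2,4) by (rule hom_one)
    then show ?thesis
      using i2(3) that assms(2) by (metis group.is_monoid inj_on_def monoid.one_closed)
  qed
  have ker: "kernel (G\<^sub>1' \<times>\<times> G\<^sub>1') (G\<^sub>2' \<times>\<times> G\<^sub>2') (map_prod (\<psi>' \<circ> \<phi> \<circ> \<theta>) (\<psi>' \<circ> \<phi> \<circ> \<theta>)) = map_prod \<psi> \<psi> ` K"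
  proof -
    have "kernel (G\<^sub>1' \<times>\<times> G\<^sub>1') (G\<^sub>2' \<times>\<times> G\<^sub>2') (map_prod (\<psi>' \<circ> \<phi> \<circ> \<theta>) (\<psi>' \<circ> \<phi> \<circ> \<theta>))
      = {z \<in> map_prod \<psi> \<psi> ` (carrier G\<^sub>1 \<times> carrier G\<^sub>1).
          map_prod (\<psi>' \<circ> \<phi> \<circ> \<theta>) (\<psi>' \<circ> \<phi> \<circ> \<theta>) z = (\<one>\<^bsub>G\<^sub>2'\<^esub>, \<one>\<^bsub>G\<^sub>2'\<^esub>)}"
      by (simp add: kernel_def DirProd_def map_prod_surj_on[OF i1(2) i1(2)])
    also have "\<dots> = map_prod \<psi> \<psi> ` {z \<in> carrier G\<^sub>1 \<times> carrier G\<^sub>1. map_prod \<phi> \<phi> z = (\<one>\<^bsub>G\<^sub>2\<^esub>, \<one>\<^bsub>G\<^sub>2\<^esub>)}"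
    proof (rule Collect_image)
      show "map_prod (\<psi>' \<circ> \<phi> \<circ> \<theta>) (\<psi>' \<circ> \<phi> \<circ> \<theta>) (map_prod \<psi> \<psi> z) = (\<one>\<^bsub>G\<^sub>2'\<^esub>, \<one>\<^bsub>G\<^sub>2'\<^esub>) \<longleftrightarrow>
          map_prod \<phi> \<phi> z = (\<one>\<^bsub>G\<^sub>2\<^esub>, \<one>\<^bsub>G\<^sub>2\<^esub>)" if "z \<in> carrier G\<^sub>1 \<times> carrier G\<^sub>1" for z
        using that \<theta> one f(2) by (cases z) auto
    qed
    finally show ?thesis
      by (simp add: f(5)[symmetric] kernel_def DirProd_def)
  qed
  have "correspondence G\<^sub>1' T\<^sub>1' (map_prod \<psi> \<psi> ` P\<^sub>1)" "correspondence G\<^sub>2' T\<^sub>2' (map_prod \<psi>' \<psi>' ` P\<^sub>2)"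
    by (rule correspondence_topological_iso[OF assms(1,3,5,7) \<psi> f(6)]
        correspondence_topological_iso[OF assms(2,4,6,8) \<psi>' f(7)])+
  moreover have "continuous_map T\<^sub>1' T\<^sub>2' (\<psi>' \<circ> \<phi> \<circ> \<theta>)"
    by (rule continuous_map_compose[OF i4 continuous_map_compose[OF f(3) i5]])
  ultimately show ?thesis
    unfolding factor_map_with_kernel_def \<theta>_def[symmetric] by (intro conjI epi img ker)
qed

section \<open>The canonical map between quotients\<close>

text \<open>Absorption \<open>H'H = H'\<close> turns the set product \<open>H' \<cdot> Hx\<close> into a single coset.\<close>

lemma canonical_map_coset:
  assumes "group G" "subgroup H G" "subgroup H' G" "H \<subseteq> H'" "x \<in> carrier G"
  shows "canonical_map G H' (H #>\<^bsub>G\<^esub> x) = H' #>\<^bsub>G\<^esub> x"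
proof -
  interpret group G by fact
  have sub: "H \<subseteq> carrier G" "H' \<subseteq> carrier G"
    using assms subgroup.subset by blast+
  have "H' <#>\<^bsub>G\<^esub> H = H'"
  proof
    show "H' <#>\<^bsub>G\<^esub> H \<subseteq> H'"
      using assms(3,4) by (auto simp: set_mult_def subgroup.m_closed)
    show "H' \<subseteq> H' <#>\<^bsub>G\<^esub> H"
    proof
      fix h assume "h \<in> H'"
      moreover have "\<one>\<^bsub>G\<^esub> \<in> H"
        using assms(2) by (rule subgroup.one_closed)
      ultimately show "h \<in> H' <#>\<^bsub>G\<^esub> H"
        using sub by (force simp: set_mult_def)
    qed
  qed
  then show ?thesis
    using setmult_rcos_assoc[OF sub(2,1) assms(5)] by (simp add: canonical_map_def)
qed

lemma quot_correspondence_eq_map_prod: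
  "quot_correspondence G H P = map_prod (\<lambda>x. H #>\<^bsub>G\<^esub> x) (\<lambda>x. H #>\<^bsub>G\<^esub> x) ` P"
  by (simp add: quot_correspondence_def map_prod_def)

lemma coset_epi_FactGroup:
  assumes "H \<lhd> G"
  shows "(\<lambda>x. H #>\<^bsub>G\<^esub> x) \<in> epi G (G Mod H)"
  using normal.r_coset_hom_Mod[OF assms] by (auto simp: epi_def FactGroup_def RCOSETS_def)

lemma correspondence_quot:
  assumes "H \<lhd> G" "topspace T = carrier G" "compact_space T"
    and "Hausdorff_space (quot_topology G T H)" "correspondence G T P"
  shows "correspondence (G Mod H) (quot_topology G T H) (quot_correspondence G H P)"
proof -
  interpret normal H G by fact
  show ?thesis
    unfolding quot_correspondence_eq_map_prod
    by (rule correspondence_image[OF _ _ assms(5,3,4) coset_epi_FactGroup[OF assms(1)]])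
      (use assms quotient_map_coset[of G H T] in
        \<open>auto simp: factorgroup_is_group is_group subgroup_axioms intro: quotient_imp_continuous_map\<close>)
qed

text \<open>
  The kernel is \<open>H'/H\<close> in each coordinate because \<open>H'x = H'\<close> says \<open>x \<in> H'\<close>.  The cosets of \<open>H\<close>
  in the subgroup \<open>H'\<close> are literally the cosets in \<open>G\<close> of elements of \<open>H'\<close>, so the quotient
  \<open>H'/H\<close> is a subset of \<open>G/H\<close>.
\<close>

lemma canonical_map_factor:
  assumes N: "H \<lhd> G" "H' \<lhd> G" "H \<subseteq> H'"
    and T: "topspace T = carrier G" "compact_space T"
    and Hd: "Hausdorff_space (quot_topology G T H)" "Hausdorff_space (quot_topology G T H')"
    and P: "correspondence G T P"
  shows "factor_map_with_kernel
      (G Mod H) (quot_topology G T H) (quot_correspondence G H P)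
      (G Mod H') (quot_topology G T H') (quot_correspondence G H' P)
      (canonical_map G H')
      (carrier (G\<lparr>carrier := H'\<rparr> Mod H) \<times> carrier (G\<lparr>carrier := H'\<rparr> Mod H))"
proof -
  interpret H: normal H G by fact
  interpret H': normal H' G by fact
  have G: "group G" "subgroup H G" "subgroup H' G"
    by (rule H.is_group H.subgroup_axioms H'.subgroup_axioms)+
  note can = canonical_map_coset[OF G N(3)]
  have carr: "carrier (G Mod K) = (\<lambda>x. K #>\<^bsub>G\<^esub> x) ` carrier G" for K
    by (auto simp: FactGroup_def RCOSETS_def)
  have "canonical_map G H' \<in> hom (G Mod H) (G Mod H')"
    unfolding hom_def carr
    by (auto simp: can H.rcos_sum H'.rcos_sum)
  moreover have "canonical_map G H' ` carrier (G Mod H) = carrier (G Mod H')"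
    unfolding carr image_image by (rule image_cong) (auto simp: can)
  moreover have "continuous_map (quot_topology G T H) (quot_topology G T H') (canonical_map G H')"
  proof (rule continuous_compose_quotient_map[OF quotient_map_coset[OF G(1,2) T(1)]])
    have "continuous_map T (quot_topology G T H') (\<lambda>x. H' #>\<^bsub>G\<^esub> x)"
      using quotient_map_coset[OF G(1,3) T(1)] by (rule quotient_imp_continuous_map)
    then show "continuous_map T (quot_topology G T H') (canonical_map G H' \<circ> (\<lambda>x. H #>\<^bsub>G\<^esub> x))"
      by (rule continuous_map_eq) (simp add: can T(1))
  qed
  moreover have "map_prod (canonical_map G H') (canonical_map G H') ` quot_correspondence G H P
      = quot_correspondence G H' P"
  proof -
    have "P \<subseteq> carrier G \<times> carrier G"
      using P by (rule correspondence_subset)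
    then show ?thesis
      unfolding quot_correspondence_eq_map_prod image_image
      by (intro image_cong) (auto simp: can)
  qed
  moreover have "kernel ((G Mod H) \<times>\<times> (G Mod H)) ((G Mod H') \<times>\<times> (G Mod H'))
      (map_prod (canonical_map G H') (canonical_map G H'))
    = carrier (G\<lparr>carrier := H'\<rparr> Mod H) \<times> carrier (G\<lparr>carrier := H'\<rparr> Mod H)"
  proof -
    have iff: "H' #>\<^bsub>G\<^esub> x = H' \<longleftrightarrow> x \<in> H'" if "x \<in> carrier G" for x
      using H.coset_join2[OF that G(3)] H.rcos_self[OF that G(3)] by blast
    have "{X \<in> carrier (G Mod H). canonical_map G H' X = H'} = (\<lambda>x. H #>\<^bsub>G\<^esub> x) ` H'"
      unfolding carr using can iff H'.subset by auto
    also have "\<dots> = carrier (G\<lparr>carrier := H'\<rparr> Mod H)"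
      by (auto simp: FactGroup_def RCOSETS_def r_coset_def)
    finally have "{X \<in> carrier (G Mod H). canonical_map G H' X = H'} = carrier (G\<lparr>carrier := H'\<rparr> Mod H)" .
    moreover have "kernel ((G Mod H) \<times>\<times> (G Mod H)) ((G Mod H') \<times>\<times> (G Mod H'))
        (map_prod (canonical_map G H') (canonical_map G H'))
      = {X \<in> carrier (G Mod H). canonical_map G H' X = H'} \<times>
        {X \<in> carrier (G Mod H). canonical_map G H' X = H'}"
      by (simp add: kernel_def DirProd_def set_eq_iff conj_ac)
    ultimately show ?thesis
      by simp
  qed
  ultimately show ?thesis
    using correspondence_quot[OF N(1) T Hd(1) P] correspondence_quot[OF N(2) T Hd(2) P]
    by (simp add: factor_map_with_kernel_def epi_def)
qed

section \<open>Continuous homomorphisms to the circle\<close>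

text \<open>
  Cauchy's functional equation: additivity gives homogeneity over the rationals, and continuity
  extends it to their closure.
\<close>

lemma additive_continuous_imp_linear:
  fixes k :: "'a::real_normed_vector \<Rightarrow> real"
  assumes add: "\<And>x y. k (x + y) = k x + k y" and cont: "continuous_on UNIV k"
  shows "linear k"
proof (rule linearI)
  fix r :: real and x :: 'a
  have nat: "k (of_nat n *\<^sub>R y) = of_nat n * k y" for n y
  proof (induction n)
    case 0
    show ?case
      using add[of 0 0] by simp
  next
    case (Suc n)
    then show ?case
      by (simp add: scaleR_add_left add algebra_simps)
  qed
  have int: "k (of_int i *\<^sub>R y) = of_int i * k y" for i y
  proof (cases "i \<ge> 0")
    case True
    then show ?thesis
      using nat[of "nat i" y] by simp
  next
    case False
    then have "of_nat (nat (- i)) = - real_of_int i"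
      by simp
    moreover have "k (- z) = - k z" for z
      using add[of z "- z"] add[of 0 0] by simp
    ultimately show ?thesis
      using nat[of "nat (- i)" y] by simp
  qed
  have rat: "k (q *\<^sub>R x) = q * k x" if "q \<in> \<rat>" for q
  proof -
    obtain a b where q: "q = of_int a / of_int b" "b > 0"
      using \<open>q \<in> \<rat>\<close> by (rule Rats_cases')
    have "of_int b * k (q *\<^sub>R x) = k (of_int b *\<^sub>R (q *\<^sub>R x))"
      by (simp only: int)
    also have "\<dots> = of_int a * k x"
      using q by (simp flip: int)
    finally have "of_int b * k (q *\<^sub>R x) = of_int b * (q * k x)"
      using q by simp
    then show ?thesis
      using q(2) by simp
  qed
  have "closed {r. k (r *\<^sub>R x) = r * k x}"
    by (intro closed_Collect_eq continuous_intros continuous_on_compose2[OF cont]) auto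
  moreover have "\<rat> \<subseteq> {r. k (r *\<^sub>R x) = r * k x}"
    using rat by blast
  ultimately have "closure \<rat> \<subseteq> {r. k (r *\<^sub>R x) = r * k x}"
    by (rule closure_minimal[rotated])
  moreover have "r \<in> closure \<rat>"
    unfolding closure_approachable
  proof (intro allI impI)
    fix e :: real assume "e > 0"
    then obtain q where "q \<in> \<rat>" "r < q" "q < r + e"
      using Rats_dense_in_real[of r "r + e"] by auto
    then show "\<exists>q\<in>\<rat>. dist q r < e"
      by (intro bexI[of _ q]) (simp_all add: dist_real_def)
  qed
  ultimately show "k (r *\<^sub>R x) = r *\<^sub>R k x"
    by auto
qed (rule add)

lemma cis_2pi_eq_iff: "cis (2 * pi * a) = cis (2 * pi * b) \<longleftrightarrow> a - b \<in> \<int>"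
proof -
  have "cis (2 * pi * a) = cis (2 * pi * b) \<longleftrightarrow> (\<exists>n::int. 2 * pi * a = 2 * pi * b + of_int (2 * n) * pi)"
    unfolding cis_conv_exp exp_eq by (simp add: complex_eq_iff)
  also have "\<dots> \<longleftrightarrow> (\<exists>n::int. a - b = of_int n)"
  proof (rule ex_cong1)
    fix n :: int
    have "2 * pi * a = 2 * pi * b + of_int (2 * n) * pi \<longleftrightarrow> 2 * pi * (a - b) = 2 * pi * of_int n"
      by (simp add: algebra_simps)
    then show "2 * pi * a = 2 * pi * b + of_int (2 * n) * pi \<longleftrightarrow> a - b = of_int n"
      by simp
  qed
  finally show ?thesis
    by (auto simp: Ints_def)
qed

text \<open>
  A continuous logarithm of \<open>u\<close>, normalised to vanish at \<open>0\<close>, is additive up to an integer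
  multiple of \<open>2\<pi>i\<close>.  That integer depends continuously on one summand, so it is constant, and it
  is \<open>0\<close> when this summand is \<open>0\<close>.
\<close>

lemma circle_hom_lift:
  fixes u :: "'a::real_normed_vector \<Rightarrow> complex"
  assumes cont: "continuous_on UNIV u" and mult: "\<And>x y. u (x + y) = u x * u y"
    and circle: "\<And>x. norm (u x) = 1"
  obtains l where "linear l" "\<And>x. u x = cis (2 * pi * l x)"
proof -
  have nz: "u x \<noteq> 0" for x
    using circle[of x] by auto
  obtain g where g: "continuous_on UNIV g" "\<And>x. u x = exp (g x)"
    using continuous_logarithm_on_contractible[OF cont _ nz] convex_imp_contractible[OF convex_UNIV]
    by (metis UNIV_I)
  have u0: "u 0 = 1"
    using mult[of 0 0] nz[of 0] by simp
  define l where "l x = Im (g x - g 0) / (2 * pi)" for x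
  have u: "u x = cis (2 * pi * l x)" for x
  proof -
    have e: "u x = exp (g x - g 0)"
      using g(2)[of x] g(2)[of 0] u0 by (simp add: exp_diff)
    then have "Re (g x - g 0) = 0"
      using circle[of x] by simp
    then show ?thesis
      by (simp add: e exp_eq_polar l_def)
  qed
  have contl: "continuous_on UNIV l"
    unfolding l_def by (intro continuous_intros g(1)) auto
  have add: "l (x + y) = l x + l y" for x y
  proof -
    let ?d = "\<lambda>x. l (x + y) - (l x + l y)"
    have int: "?d x \<in> \<int>" for x
    proof -
      have "cis (2 * pi * l (x + y)) = cis (2 * pi * (l x + l y))"
        using mult[of x y] by (simp add: u cis_mult algebra_simps)
      then show ?thesis
        by (simp add: cis_2pi_eq_iff)
    qed
    have "?d constant_on UNIV"
    proof (rule continuous_discrete_range_constant)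
      show "continuous_on UNIV ?d"
        by (intro continuous_intros continuous_on_compose2[OF contl]) auto
      show "\<exists>e>0. \<forall>y'. y' \<in> UNIV \<and> ?d y' \<noteq> ?d x \<longrightarrow> e \<le> norm (?d y' - ?d x)" for x
      proof (intro exI[of _ 1] conjI allI impI)
        fix y' assume "y' \<in> UNIV \<and> ?d y' \<noteq> ?d x"
        then have "?d y' - ?d x \<in> \<int>" "?d y' - ?d x \<noteq> 0"
          using Ints_diff[OF int int] by auto
        then show "1 \<le> norm (?d y' - ?d x)"
          unfolding real_norm_def by (rule Ints_nonzero_abs_ge1)
      qed simp
    qed auto
    then obtain c where "\<And>x. ?d x = c"
      unfolding constant_on_def by blast
    from this[of x] this[of 0] have "?d x = ?d 0"
      by (rule trans[OF _ sym])
    moreover have "l 0 = 0"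
      by (simp add: l_def)
    ultimately show ?thesis
      by simp
  qed
  show thesis
    using that[OF additive_continuous_imp_linear[OF add contl] u] .
qed

section \<open>The torus as a compact Hausdorff group\<close>

abbreviation torus_proj :: "real^'m \<Rightarrow> (real^'m) set"
  where "torus_proj x \<equiv> int_lattice #>\<^bsub>vec_group\<^esub> x"

lemma comm_group_vec_group: "comm_group (vec_group :: (real^'m::finite) monoid)"
  by (rule comm_groupI) (auto simp: vec_group_def algebra_simps intro: exI[of _ "- _"])

lemma subgroup_int_lattice: "subgroup (int_lattice :: (real^'m::finite) set) vec_group"
proof -
  interpret comm_group "vec_group :: (real^'m) monoid"
    by (rule comm_group_vec_group)
  have inv: "inv\<^bsub>vec_group\<^esub> x = - x" for x :: "real^'m"
    by (rule inv_equality) (auto simp: vec_group_def)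
  show ?thesis
    by unfold_locales (auto simp: inv, auto simp: vec_group_def int_lattice_def)
qed

lemma normal_int_lattice: "int_lattice \<lhd> (vec_group :: (real^'m::finite) monoid)"
  by (rule comm_group.subgroup_imp_normal[OF comm_group_vec_group subgroup_int_lattice])

lemma comm_group_torus: "comm_group (torus :: (real^'m::finite) set monoid)"
  unfolding torus_def by (rule comm_group.abelian_FactGroup[OF comm_group_vec_group subgroup_int_lattice])

lemma carrier_torus: "carrier torus = range torus_proj"
  by (auto simp: torus_def FactGroup_def RCOSETS_def vec_group_def)

lemma quotient_map_torus_proj:
  "quotient_map euclidean torus_top (torus_proj :: real^'m::finite \<Rightarrow> _)"
  unfolding torus_top_def
  using comm_group_vec_group subgroup_int_lattice
  by (intro quotient_map_coset) (auto simp: comm_group_def vec_group_def)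

lemma topspace_torus: "topspace (torus_top :: (real^'m::finite) set topology) = carrier torus"
  unfolding torus_top_def torus_def
  using comm_group_vec_group subgroup_int_lattice
  by (intro topspace_quot_topology) (auto simp: comm_group_def vec_group_def)

lemma mem_int_lattice: "x \<in> int_lattice \<longleftrightarrow> (\<forall>i. x $ i \<in> \<int>)"
  by (simp add: int_lattice_def)

lemma mem_torus_proj: "y \<in> torus_proj x \<longleftrightarrow> y - x \<in> int_lattice"
  by (force simp: r_coset_def vec_group_def intro: bexI[of _ "y - x"])

lemma torus_proj_eq_iff:
  fixes x y :: "real^'m::finite"
  shows "torus_proj x = torus_proj y \<longleftrightarrow> x - y \<in> int_lattice"
proof -
  have "torus_proj x = torus_proj y" if "x - y \<in> int_lattice"
  proof -
    have "group (vec_group :: (real^'m) monoid)"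
      by (rule comm_group.axioms(2)[OF comm_group_vec_group])
    then have "torus_proj y = torus_proj x"
      using that by (intro group.repr_independence[OF _ _ _ subgroup_int_lattice])
        (simp_all add: mem_torus_proj, simp add: vec_group_def)
    then show ?thesis ..
  qed
  moreover have "x - y \<in> int_lattice" if "torus_proj x = torus_proj y"
    unfolding mem_torus_proj[symmetric] that[symmetric] by (simp add: mem_torus_proj mem_int_lattice)
  ultimately show ?thesis
    by blast
qed

lemma torus_proj_add: "torus_proj x \<otimes>\<^bsub>torus\<^esub> torus_proj y = torus_proj (x + y :: real^'m::finite)"
  using normal.rcos_sum[OF normal_int_lattice, of x y] by (simp add: torus_def vec_group_def)

text \<open>
  The embedding of the torus into \<open>\<complex>\<^sup>m\<close> by its coordinate characters.  The choice of a
  representative is immaterial, see \<open>torus_char_proj\<close>.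
\<close>

definition torus_char :: "(real^'m) set \<Rightarrow> complex^'m"
  where "torus_char X = (\<chi> i. cis (2 * pi * (SOME x. x \<in> X) $ i))"

lemma torus_char_proj: "torus_char (torus_proj x) = (\<chi> i. cis (2 * pi * x $ i))"
  for x :: "real^'m::finite"
proof -
  have "x \<in> torus_proj x"
    by (simp add: mem_torus_proj mem_int_lattice)
  then have "(SOME y. y \<in> torus_proj x) \<in> torus_proj x"
    by (rule someI)
  then show ?thesis
    by (auto simp: torus_char_def vec_eq_iff cis_2pi_eq_iff mem_torus_proj mem_int_lattice)
qed

lemma torus_char_inj: "inj_on torus_char (carrier (torus :: (real^'m::finite) set monoid))"
  by (auto simp: inj_on_def carrier_torus torus_char_proj torus_proj_eq_iff vec_eq_iff
      cis_2pi_eq_iff mem_int_lattice)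

lemma continuous_torus_char: "continuous_map (torus_top :: (real^'m::finite) set topology) euclidean torus_char"
proof (rule continuous_compose_quotient_map[OF quotient_map_torus_proj])
  have "continuous_on UNIV (\<lambda>x::real^'m. \<chi> i. cis (2 * pi * x $ i))"
    by (intro continuous_intros)
  then show "continuous_map euclidean euclidean (torus_char \<circ> (torus_proj :: real^'m \<Rightarrow> _))"
    by (simp add: o_def torus_char_proj)
qed

lemma Hausdorff_torus: "Hausdorff_space (torus_top :: (real^'m::finite) set topology)"
  by (rule Hausdorff_space_injective_preimage[OF _ continuous_torus_char])
    (auto simp: topspace_torus torus_char_inj)

lemma compact_torus: "compact_space (torus_top :: (real^'m::finite) set topology)"
proof -
  have "torus_proj ` cbox 0 1 = topspace (torus_top :: (real^'m) set topology)"
  proof -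
    \<comment> \<open>The unit cube contains a fundamental domain: reduce every coordinate to its fractional part.\<close>
    have "\<exists>y \<in> cbox 0 1. torus_proj x = torus_proj y" for x :: "real^'m"
      by (rule bexI[of _ "\<chi> i. frac (x $ i)"])
        (auto simp: torus_proj_eq_iff mem_int_lattice mem_box_cart frac_def intro: less_imp_le[OF frac_lt_1[unfolded frac_def]])
    then show ?thesis
      by (auto simp: topspace_torus carrier_torus)
  qed
  moreover have "compactin torus_top (torus_proj ` cbox 0 (1 :: real^'m))"
    by (rule image_compactin[OF _ quotient_imp_continuous_map[OF quotient_map_torus_proj]]) simp
  ultimately show ?thesis
    by (simp only: compact_space_def)
qed

section \<open>Automorphisms of the torus\<close>

text \<open>
  A point of the target torus is determined by its coordinate characters, so lifting the
  characters of \<open>f\<close> one at a time lifts \<open>f\<close>.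
\<close>

lemma torus_hom_lift:
  fixes f :: "(real^'m::finite) set \<Rightarrow> (real^'n::finite) set"
  assumes hom: "f \<in> hom torus torus" and cont: "continuous_map torus_top torus_top f"
  obtains L where "linear L" "\<And>x. f (torus_proj x) = torus_proj (L x)"
proof -
  let ?u = "\<lambda>i x. torus_char (f (torus_proj x)) $ i"
  have carr: "f (torus_proj x) \<in> carrier torus" for x
    using hom by (auto simp: hom_def carrier_torus)
  have "\<exists>l. linear l \<and> (\<forall>x. ?u i x = cis (2 * pi * l x))" for i
  proof (rule circle_hom_lift)
    have "continuous_map euclidean euclidean (torus_char \<circ> f \<circ> torus_proj)"
      by (intro continuous_map_compose[OF _ continuous_map_compose[OF cont continuous_torus_char]]
          quotient_imp_continuous_map[OF quotient_map_torus_proj, folded o_assoc])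
    then show "continuous_on UNIV (?u i)"
      by (auto simp: o_def intro: continuous_intros)
    show "?u i (x + y) = ?u i x * ?u i y" for x y
    proof -
      obtain a b where ab: "f (torus_proj x) = torus_proj a" "f (torus_proj y) = torus_proj b"
        using carr by (metis carrier_torus imageE)
      have "f (torus_proj (x + y)) = torus_proj (a + b)"
        using hom ab by (simp add: hom_mult carrier_torus flip: torus_proj_add)
      then show ?thesis
        by (simp add: ab torus_char_proj cis_mult algebra_simps)
    qed
    show "norm (?u i x) = 1" for x
      by (simp add: torus_char_def)
  qed blast
  then obtain l where l: "\<And>i. linear (l i)" "\<And>i x. ?u i x = cis (2 * pi * l i x)"
    by metis
  define L where "L x = (\<chi> i. l i x)" for x
  have "linear L"
    using l(1) by (auto simp: L_def linear_iff vec_eq_iff)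
  moreover have "f (torus_proj x) = torus_proj (L x)" for x
  proof (rule inj_onD[OF torus_char_inj])
    show "torus_char (f (torus_proj x)) = torus_char (torus_proj (L x))"
      using l(2) by (simp add: torus_char_proj vec_eq_iff L_def)
  qed (use carr in \<open>auto simp: carrier_torus\<close>)
  ultimately show thesis
    using that by blast
qed

text \<open>The columns of the matrix of \<open>L\<close> are the images of the standard basis vectors, which are
  lattice points.\<close>

lemma int_matrix_of_lattice_map:
  fixes L :: "real^'m::finite \<Rightarrow> real^'m"
  assumes "linear L" "\<And>x. x \<in> int_lattice \<Longrightarrow> L x \<in> int_lattice"
  obtains B :: "int^'m^'m" where "\<And>x. L x = map_matrix real_of_int B *v x"
proof
  have "L (axis j 1) $ i \<in> \<int>" for i j
    using assms(2)[of "axis j 1"] by (auto simp: mem_int_lattice axis_def)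
  then have "map_matrix real_of_int (map_matrix floor (matrix L)) = matrix L"
    by (auto simp: vec_eq_iff matrix_def Ints_def)
  then show "L x = map_matrix real_of_int (map_matrix floor (matrix L)) *v x" for x
    using matrix_works[of L x] assms(1) by (simp add: linear_matrix_vector_mul_eq)
qed

lemma map_matrix_of_int_mult:
  "map_matrix real_of_int (A ** B) = map_matrix real_of_int A ** map_matrix real_of_int B"
  by (simp add: vec_eq_iff matrix_matrix_mult_def)

lemma map_matrix_of_int_eq_iff: "map_matrix real_of_int A = map_matrix real_of_int B \<longleftrightarrow> A = B"
  by (simp add: vec_eq_iff)

lemma map_matrix_of_int_mat: "map_matrix real_of_int (mat 1) = mat 1"
  by (simp add: vec_eq_iff mat_def)

lemma lattice_preserving:
  fixes A :: "int^'m::finite^'m"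
  assumes "x \<in> int_lattice"
  shows "map_matrix real_of_int A *v x \<in> int_lattice"
  using assms by (auto simp: mem_int_lattice matrix_vector_mult_def intro!: Ints_sum Ints_mult)

lemma toral_map_proj:
  fixes A :: "int^'m::finite^'m"
  shows "toral_map A (torus_proj x) = torus_proj (map_matrix real_of_int A *v x)"
proof -
  have "torus_proj (map_matrix real_of_int A *v y) = torus_proj (map_matrix real_of_int A *v x)"
    if "y \<in> torus_proj x" for y
    using lattice_preserving[of "y - x" A] that
    by (simp add: torus_proj_eq_iff mem_torus_proj matrix_vector_mult_diff_distrib)
  moreover have "x \<in> torus_proj x"
    by (simp add: mem_torus_proj mem_int_lattice)
  ultimately show ?thesis
    unfolding toral_map_def by blast
qed

text \<open>
  Injectivity of \<open>f\<close> makes its lift \<open>L\<close> reflect the lattice.  This yields both the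
  injectivity of \<open>L\<close> and the integrality of the inverse matrix.
\<close>

lemma continuous_torus_automorphism_is_toral:
  fixes f :: "(real^'m::finite) set \<Rightarrow> (real^'m) set"
  assumes iso: "f \<in> iso torus torus" and cont: "continuous_map torus_top torus_top f"
  obtains B :: "int^'m^'m" where "B \<in> GL_int" "\<And>X. X \<in> carrier torus \<Longrightarrow> f X = toral_map B X"
proof -
  have hom: "f \<in> hom torus torus" and inj: "inj_on f (carrier torus)"
    using iso by (auto simp: iso_def bij_betw_def)
  obtain L where L: "linear L" "\<And>x. f (torus_proj x) = torus_proj (L x)"
    using torus_hom_lift[OF hom cont] by blast
  have L0: "L 0 = 0"
    using L(1) by (rule linear_0)
  have lat: "L x \<in> int_lattice \<longleftrightarrow> x \<in> int_lattice" for x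
  proof -
    have "L x \<in> int_lattice \<longleftrightarrow> f (torus_proj x) = f (torus_proj 0)"
      by (simp add: L(2) L0 torus_proj_eq_iff)
    also have "\<dots> \<longleftrightarrow> torus_proj x = torus_proj 0"
      using inj by (auto simp: inj_on_def carrier_torus)
    finally show ?thesis
      by (simp add: torus_proj_eq_iff)
  qed
  have "inj L"
    unfolding linear_injective_0[OF L(1)]
  proof (intro allI impI)
    fix x assume "L x = 0"
    then have "t *\<^sub>R x \<in> int_lattice" for t
      using lat[of "t *\<^sub>R x"] by (simp add: linear_cmul[OF L(1)] mem_int_lattice)
    then have int: "t * x $ i \<in> \<int>" for t i
      by (simp add: mem_int_lattice)
    have "x $ i = 0" for i
    proof (rule ccontr)
      assume "x $ i \<noteq> 0"
      \<comment> \<open>The multiple of \<open>x\<close> whose coordinate \<open>i\<close> is \<open>1/2\<close> would be a lattice point.\<close>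
      then have "1 / 2 \<in> (\<int> :: real set)"
        using int[of "1 / (2 * x $ i)" i] by simp
      then show False
        using Ints_nonzero_abs_less1[of "1 / 2 :: real"] by simp
    qed
    then show "x = 0"
      by (simp add: vec_eq_iff)
  qed
  then obtain M where M: "linear M" "\<And>x. M (L x) = x" "\<And>x. L (M x) = x"
    using linear_injective_isomorphism[OF L(1)] by metis
  obtain B :: "int^'m^'m" where B: "\<And>x. L x = map_matrix real_of_int B *v x"
    using int_matrix_of_lattice_map[OF L(1)] lat by metis
  obtain C :: "int^'m^'m" where C: "\<And>x. M x = map_matrix real_of_int C *v x"
    using int_matrix_of_lattice_map[OF M(1)] lat M(3) by metis
  have "map_matrix real_of_int (B ** C) = map_matrix real_of_int (mat 1)"
    "map_matrix real_of_int (C ** B) = map_matrix real_of_int (mat 1)"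
    unfolding map_matrix_of_int_mult map_matrix_of_int_mat matrix_eq
    by (simp_all add: M(2,3) flip: matrix_vector_mul_assoc B C)
  then have "B \<in> GL_int"
    by (auto simp: GL_int_def invertible_def map_matrix_of_int_eq_iff)
  moreover have "f X = toral_map B X" if "X \<in> carrier torus" for X
    using that L(2) B by (auto simp: carrier_torus toral_map_proj)
  ultimately show thesis
    using that by blast
qed

theorem corollary3p4:
  fixes A :: "int^'m::finite^'m"
    and H H' :: "(real^'m) set set"
    and \<psi> \<psi>' :: "(real^'m) set set \<Rightarrow> (real^'m) set"
  assumes "A \<in> GL_int"
    and "finite_to_one_correspondence torus torus_top (toral_graph A)"
    and "subgroup H torus" and "finite H"
    and "subgroup H' torus" and "finite H'"
    and "H \<subseteq> H'"
    and "doubly_invariant torus torus_top (toral_graph A) H'"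
    and "topological_iso (torus Mod H) (quot_topology torus torus_top H) torus torus_top \<psi>"
    and "topological_iso (torus Mod H') (quot_topology torus torus_top H') torus torus_top \<psi>'"
  shows "\<exists>A'' \<in> GL_int.
    map_prod \<psi>' \<psi>' ` quot_correspondence torus H' (toral_graph A) = toral_graph A'' \<and>
    factor_map_with_kernel
      (torus Mod H) (quot_topology torus torus_top H)
      (quot_correspondence torus H (toral_graph A))
      (torus Mod H') (quot_topology torus torus_top H')
      (quot_correspondence torus H' (toral_graph A))
      (canonical_map torus H')
      (carrier (torus\<lparr>carrier := H'\<rparr> Mod H) \<times> carrier (torus\<lparr>carrier := H'\<rparr> Mod H)) \<and>
    factor_map_with_kernel
      torus torus_top (map_prod \<psi> \<psi> ` quot_correspondence torus H (toral_graph A))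
      torus torus_top (toral_graph A'')
      (\<psi>' \<circ> canonical_map torus H' \<circ> inv_into (carrier (torus Mod H)) \<psi>)
      (map_prod \<psi> \<psi> ` (carrier (torus\<lparr>carrier := H'\<rparr> Mod H) \<times> carrier (torus\<lparr>carrier := H'\<rparr> Mod H)))"
proof -
  let ?P = "toral_graph A"
  have T: "group (torus :: (real^'m) set monoid)"
    by (rule comm_group.axioms(2)[OF comm_group_torus])
  have N: "H \<lhd> torus" "H' \<lhd> torus"
    using comm_group.subgroup_imp_normal[OF comm_group_torus] assms(3,5) by auto
  have G: "group (torus Mod H)" "group (torus Mod H')"
    using N by (simp_all add: normal.factorgroup_is_group)
  have top: "topspace (quot_topology torus torus_top H) = carrier (torus Mod H)"
    "topspace (quot_topology torus torus_top H') = carrier (torus Mod H')"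
    using topspace_quot_topology[OF T _ topspace_torus] assms(3,5) by auto
  have Hd: "Hausdorff_space (quot_topology torus torus_top H)"
    "Hausdorff_space (quot_topology torus torus_top H')"
    using assms(9,10) Hausdorff_torus unfolding topological_iso_def
    by (metis homeomorphic_Hausdorff_space homeomorphic_map_imp_homeomorphic_space)+
  have P: "correspondence torus torus_top ?P"
    using assms(2) by (simp add: finite_to_one_correspondence_def)
  note fac = canonical_map_factor[OF N assms(7) topspace_torus compact_torus Hd P]

  \<comment> \<open>Conjugate the automorphism of the quotient by \<open>H'\<close> whose graph is \<open>P/(H' \<times> H')\<close> to one of the torus.\<close>
  obtain f where f: "f \<in> iso (torus Mod H') (torus Mod H')"
    "continuous_map (quot_topology torus torus_top H') (quot_topology torus torus_top H') f"
    "quot_correspondence torus H' ?P = graph_on (carrier (torus Mod H')) f"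
    using assms(8) by (auto simp: doubly_invariant_def)
  define \<theta> where "\<theta> = inv_into (carrier (torus Mod H')) \<psi>'"
  have \<psi>': "\<psi>' \<in> iso (torus Mod H') torus"
    "continuous_map (quot_topology torus torus_top H') torus_top \<psi>'"
    using assms(10) by (auto simp: topological_iso_def intro: homeomorphic_imp_continuous_map)
  have \<theta>: "\<theta> \<in> iso torus (torus Mod H')"
    "continuous_map torus_top (quot_topology torus torus_top H') \<theta>"
    unfolding \<theta>_def by (rule topological_iso_inverse[OF G(2) top(2) assms(10)])+
  have "\<psi>' \<circ> f \<circ> \<theta> \<in> iso torus torus"
    using iso_set_trans[OF iso_set_trans[OF \<theta>(1) f(1)] \<psi>'(1)] by (simp add: o_assoc)
  moreover have "continuous_map torus_top torus_top (\<psi>' \<circ> f \<circ> \<theta>)"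
    by (rule continuous_map_compose[OF \<theta>(2) continuous_map_compose[OF f(2) \<psi>'(2)]])
  ultimately obtain B :: "int^'m^'m" where B: "B \<in> GL_int"
    "\<And>X. X \<in> carrier torus \<Longrightarrow> (\<psi>' \<circ> f \<circ> \<theta>) X = toral_map B X"
    by (rule continuous_torus_automorphism_is_toral) blast
  have \<psi>'_image: "carrier torus = \<psi>' ` carrier (torus Mod H')" and "inj_on \<psi>' (carrier (torus Mod H'))"
    using \<psi>'(1) by (auto simp: iso_def bij_betw_def)
  then have B': "\<psi>' (f Y) = toral_map B (\<psi>' Y)" if "Y \<in> carrier (torus Mod H')" for Y
    using B(2)[of "\<psi>' Y"] that by (simp add: \<theta>_def)
  have graph: "map_prod \<psi>' \<psi>' ` quot_correspondence torus H' ?P = toral_graph B"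
    unfolding f(3) unfolding toral_graph_def graph_on_def \<psi>'_image Setcompr_eq_image image_image map_prod_simp
    by (rule image_cong) (simp_all add: B')
  show ?thesis
  proof (intro bexI[of _ B] conjI)
    show "factor_map_with_kernel torus torus_top (map_prod \<psi> \<psi> ` quot_correspondence torus H ?P)
      torus torus_top (toral_graph B)
      (\<psi>' \<circ> canonical_map torus H' \<circ> inv_into (carrier (torus Mod H)) \<psi>)
      (map_prod \<psi> \<psi> ` (carrier (torus\<lparr>carrier := H'\<rparr> Mod H) \<times> carrier (torus\<lparr>carrier := H'\<rparr> Mod H)))"
      unfolding graph[symmetric]
      by (rule factor_map_transport[OF G T T top topspace_torus topspace_torus assms(9,10) fac])
  qed (rule graph fac B(1))+
qed

end
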